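(* Suppose that for all $a,a'\in\Delta(\mathcal B)$, $\phi(a,t)-\phi(a',t)$ is single-crossing in $t$. Then a bundle $b\in\mathcal B$ is a never strict best response if and only if $b$ is very weakly dominated.
   Context: Setup. There are $n\ge 1$ goods; $\mathcal B=2^{\{1,\dots,n\}}$ is the set of (deterministic) bundles and $\Delta(\mathcal B)$ is the set of probability distributions on $\mathcal B$ (stochastic bundles); a bundle $b$ is identified with the point mass at $b$. Types $t$ lie in $T=[\underline t,\bar t]\subseteq\mathbb R$, $\underline t<\bar t$, and are distributed according to $F$ with a continuous, positive density $f$. The value function $v:\Delta(\mathcal B)\times T\to\mathbb R$ is continuously differentiable in $t$, with $v(\emptyset,t)=0$ for all $t$ and $v(a,t)=\mathbb E_{b\sim a}[v(b,t)]$. The virtual value function is $\phi(b,t)=v(b,t)-\frac{1-F(t)}{f(t)}v_t(b,t)$, $v_t=\partial v/\partial t$, extended by $\phi(a,t)=\mathbb E_{b\sim a}[\phi(b,t)]$ for $a\in\Delta(\mathcal B)$. Standing assumptions: for $b\ne b'$ in $\mathcal B$ there is $t\in T$ with $\phi(b,t)\neq\phi(b',t)$; and $\max_{b\neq\emptyset}\phi(b,\underline t)<0=\phi(\emptyset,\underline t)$. Terminology. A function $g:T\to\mathbb R$ is single-crossing in $t$ if $\operatorname{sign}[g(t)]\in\{-1,0,1\}$ is a monotonic function of $t$ (either weakly increasing or weakly decreasing). A stochastic bundle $a\in\Delta(\mathcal B)$ is very weakly dominated if there exists $a'\in\Delta(\mathcal B)$, $a'\ne a$, such that $\phi(a,t)\le\phi(a',t)$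 for all $t\in T$. A bundle $b\in\mathcal B$ is a never strict best response if for every $t\in T$ there exists $b'\in\mathcal B$, $b'\ne b$ (possibly depending on $t$), such that $\phi(b,t)\le\phi(b',t)$. *)

theory Defs
  imports "HOL-Probability.Probability"
begin

definition bundles :: "nat \<Rightarrow> nat set set" where
  "bundles n = Pow {1..n}"

definition stochastic_bundles :: "nat \<Rightarrow> nat set pmf set" where
  "stochastic_bundles n = {a. set_pmf a \<subseteq> bundles n}"

text \<open>
  A bundle \<open>b\<close> is identified with the point mass \<open>return_pmf b\<close>, so the functions
  \<open>v\<close> and \<open>\<phi>\<close> below take distributions as arguments.
  The derivative in the type is taken within \<open>T\<close>, hence one-sided at the end points.
\<close>

definition value_deriv ::
    "real set \<Rightarrow> (nat set pmf \<Rightarrow> real \<Rightarrow> real) \<Rightarrow> nat set pmf \<Rightarrow> real \<Rightarrow> real" where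
  "value_deriv T v a t = vector_derivative (v a) (at t within T)"

definition bundle_virtual_value ::
    "real set \<Rightarrow> real measure \<Rightarrow> (real \<Rightarrow> real) \<Rightarrow> (nat set pmf \<Rightarrow> real \<Rightarrow> real)
      \<Rightarrow> nat set \<Rightarrow> real \<Rightarrow> real" where
  "bundle_virtual_value T F f v b t =
     v (return_pmf b) t - (1 - cdf F t) / f t * value_deriv T v (return_pmf b) t"

definition virtual_value ::
    "real set \<Rightarrow> real measure \<Rightarrow> (real \<Rightarrow> real) \<Rightarrow> (nat set pmf \<Rightarrow> real \<Rightarrow> real)
      \<Rightarrow> nat set pmf \<Rightarrow> real \<Rightarrow> real" where
  "virtual_value T F f v a t =
     measure_pmf.expectation a (\<lambda>b. bundle_virtual_value T F f v b t)"

text \<open>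
  The type distribution \<open>F\<close> is a probability measure on the real line, concentrated on
  \<open>T = {lo..hi}\<close>; its distribution function is \<open>cdf F\<close>.
  The functions \<open>v\<close> and \<open>f\<close> are constrained only for types in \<open>T\<close> and, in the case of
  \<open>v\<close>, only for distributions over subsets of \<open>{1..n}\<close>.
\<close>

locale bundling_model =
  fixes n :: nat and lo hi :: real
    and F :: "real measure" and f :: "real \<Rightarrow> real"
    and v :: "nat set pmf \<Rightarrow> real \<Rightarrow> real"
  assumes goods: "n \<ge> 1"
    and types: "lo < hi"
    and prob: "prob_space F"
    and density: "F = density lborel (\<lambda>t. ennreal (f t * indicator {lo..hi} t))"
    and density_continuous: "continuous_on {lo..hi} f"
    and density_pos: "\<And>t. t \<in> {lo..hi} \<Longrightarrow> f t > 0"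
    and value_differentiable:
      "\<And>a t. a \<in> stochastic_bundles n \<Longrightarrow> t \<in> {lo..hi} \<Longrightarrow>
         v a differentiable (at t within {lo..hi})"
    and value_deriv_continuous:
      "\<And>a. a \<in> stochastic_bundles n \<Longrightarrow> continuous_on {lo..hi} (value_deriv {lo..hi} v a)"
    and value_empty: "\<And>t. t \<in> {lo..hi} \<Longrightarrow> v (return_pmf {}) t = 0"
    and value_expectation:
      "\<And>a t. a \<in> stochastic_bundles n \<Longrightarrow> t \<in> {lo..hi} \<Longrightarrow>
         v a t = measure_pmf.expectation a (\<lambda>b. v (return_pmf b) t)"
    and virtual_value_distinct:
      "\<And>b b'. b \<in> bundles n \<Longrightarrow> b' \<in> bundles n \<Longrightarrow> b \<noteq> b' \<Longrightarrow>
         \<exists>t\<in>{lo..hi}. virtual_value {lo..hi} F f v (return_pmf b) t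
                     \<noteq> virtual_value {lo..hi} F f v (return_pmf b') t"
    and virtual_value_lowest:
      "(MAX b\<in>bundles n - {{}}. virtual_value {lo..hi} F f v (return_pmf b) lo) < 0"
      "virtual_value {lo..hi} F f v (return_pmf {}) lo = 0"

definition single_crossing_on :: "real set \<Rightarrow> (real \<Rightarrow> real) \<Rightarrow> bool" where
  "single_crossing_on T g \<longleftrightarrow>
     mono_on T (\<lambda>t. sgn (g t)) \<or> antimono_on T (\<lambda>t. sgn (g t))"

definition very_weakly_dominated ::
    "nat \<Rightarrow> real set \<Rightarrow> (nat set pmf \<Rightarrow> real \<Rightarrow> real) \<Rightarrow> nat set pmf \<Rightarrow> bool" where
  "very_weakly_dominated n T \<phi> a \<longleftrightarrow>
     (\<exists>a'\<in>stochastic_bundles n. a' \<noteq> a \<and> (\<forall>t\<in>T. \<phi> a t \<le> \<phi> a' t))"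

definition never_strict_best_response ::
    "nat \<Rightarrow> real set \<Rightarrow> (nat set pmf \<Rightarrow> real \<Rightarrow> real) \<Rightarrow> nat set \<Rightarrow> bool" where
  "never_strict_best_response n T \<phi> b \<longleftrightarrow>
     (\<forall>t\<in>T. \<exists>b'\<in>bundles n. b' \<noteq> b \<and> \<phi> (return_pmf b) t \<le> \<phi> (return_pmf b') t)"

end

theory Submission
  imports Defs
begin

text \<open>
  Let \<open>b\<close> be a never strict best response and put \<open>g\<^sub>c = \<phi>(c, \<cdot>) - \<phi>(b, \<cdot>)\<close> for \<open>c \<noteq> b\<close>. The sets
  \<open>{g\<^sub>c \<ge> 0}\<close> are closed, cover \<open>T\<close>, and by single crossing each nonempty one contains an end point.
  As \<open>T\<close> is connected, some set containing the lower end point meets some set containing the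
  upper one, so there are \<open>c, d\<close> and a type at which \<open>g\<^sub>c, g\<^sub>d \<ge> 0\<close>. Hence no mixture of
  \<open>g\<^sub>c\<close> and \<open>g\<^sub>d\<close> is negative at both end points, and therefore some mixture is negative at
  neither; by single crossing, that one is nonnegative on all of \<open>T\<close>.
\<close>

text \<open>The sign at \<open>t\<close> lies between the signs at \<open>s\<close> and
  \<open>u\<close>, whichever way it is monotone. Its lower bound gives this lemma, its upper bound
  the next one.\<close>

lemma single_crossing_on_neg_endpoint:
  assumes "single_crossing_on T g" "s \<in> T" "t \<in> T" "u \<in> T" "s \<le> t" "t \<le> u" "g t < 0"
  shows "g s < 0 \<or> g u < 0"
proof -
  have "sgn (g s) \<le> sgn (g t) \<or> sgn (g u) \<le> sgn (g t)"
    using assms unfolding single_crossing_on_def by (blast dest: monotone_onD)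
  then show ?thesis
    using \<open>g t < 0\<close> by (auto simp: sgn_real_def split: if_splits)
qed

lemma single_crossing_on_neg_between:
  assumes "single_crossing_on T g" "s \<in> T" "t \<in> T" "u \<in> T" "s \<le> t" "t \<le> u" "g s < 0" "g u < 0"
  shows "g t < 0"
proof -
  have "sgn (g t) \<le> sgn (g u) \<or> sgn (g t) \<le> sgn (g s)"
    using assms unfolding single_crossing_on_def by (blast dest: monotone_onD)
  then show ?thesis
    using assms(7,8) by (auto simp: sgn_real_def split: if_splits)
qed

text \<open>The points \<open>(a, b)\<close> and \<open>(c, d)\<close> lie in the fourth and second
  quadrants, so the segment joining them meets the closed first quadrant or the open third one. The
  sign of the determinant \<open>a * d - b * c\<close> tells on which side of the origin it
  passes.\<close>

lemma weight_same_sign: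
  fixes a b c d :: real
  assumes "a \<ge> 0" "b < 0" "c < 0" "d \<ge> 0"
  obtains p where "p \<in> {0..1}" "p * a + (1 - p) * c \<ge> 0" "p * b + (1 - p) * d \<ge> 0"
  | p where "p \<in> {0..1}" "p * a + (1 - p) * c < 0" "p * b + (1 - p) * d < 0"
proof (cases "b * c \<le> a * d")
  case True
  \<comment> \<open>This weight puts the mixture on the first axis, where its other coordinate has
    the sign of the determinant.\<close>
  define p where "p = d / (d - b)"
  have q: "1 - p = - b / (d - b)"
    unfolding p_def using assms by (simp add: field_simps)
  have "p * a + (1 - p) * c = (a * d - b * c) / (d - b)"
    unfolding q unfolding p_def using assms by (simp add: diff_divide_distrib mult.commute)
  moreover have "p * b + (1 - p) * d = 0"
    unfolding q unfolding p_def by simp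
  moreover have "p \<in> {0..1}"
    unfolding p_def using assms by auto
  ultimately show thesis
    using True assms by (intro that(1)[of p]) auto
next
  case False
  define S where "S = a - b - c + d"
  have S: "S > 0"
    unfolding S_def using assms by simp
  \<comment> \<open>This weight puts the mixture on the diagonal: both coordinates equal the
    determinant over \<open>S\<close>, which is now negative.\<close>
  define p where "p = (d - c) / S"
  have q: "1 - p = (a - b) / S"
    unfolding p_def using S by (simp add: field_simps S_def)
  have "p * a + (1 - p) * c = (a * d - b * c) / S" "p * b + (1 - p) * d = (a * d - b * c) / S"
    unfolding q unfolding p_def by (simp_all add: add_divide_distrib[symmetric] algebra_simps)
  moreover have "p \<in> {0..1}"
    unfolding p_def using S assms by (auto simp: S_def)
  ultimately show thesis
    using False S by (intro that(2)[of p]) (auto simp: divide_less_0_iff)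
qed

text \<open>This is the core argument freed from bundles; it is applied with \<open>I\<close> the
  bundles other than \<open>b\<close> and \<open>g c\<close> the excess of the virtual value of
  \<open>c\<close> over that of \<open>b\<close>.\<close>

lemma nonneg_convex_combination:
  fixes g :: "'a \<Rightarrow> real \<Rightarrow> real"
  assumes "lo \<le> hi" and fin: "finite I"
    and cont: "\<And>i. i \<in> I \<Longrightarrow> continuous_on {lo..hi} (g i)"
    and cover: "\<And>t. t \<in> {lo..hi} \<Longrightarrow> \<exists>i\<in>I. g i t \<ge> 0"
    and sc: "\<And>i j p. i \<in> I \<Longrightarrow> j \<in> I \<Longrightarrow> p \<in> {0..1} \<Longrightarrow>
      single_crossing_on {lo..hi} (\<lambda>t. p * g i t + (1 - p) * g j t)"
  shows "\<exists>i\<in>I. \<exists>j\<in>I. \<exists>p\<in>{0..1}. \<forall>t\<in>{lo..hi}. p * g i t + (1 - p) * g j t \<ge> 0"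
proof -
  \<comment> \<open>The types covered by some function that is itself nonnegative at the end point
    \<open>e\<close>. As a finite union of closed sets, \<open>A e\<close> is closed.\<close>
  define A where "A e = (\<Union>i\<in>{i\<in>I. g i e \<ge> 0}. {t\<in>{lo..hi}. g i t \<ge> 0})" for e
  have sc1: "single_crossing_on {lo..hi} (g i)" if "i \<in> I" for i
    using sc[OF that that, of 1] by simp
  have closed: "closed (A e)" for e
    unfolding A_def using fin cont
    by (intro closed_UN ballI continuous_on_closed_Collect_le) auto
  have "{lo..hi} \<subseteq> A lo \<union> A hi"
  proof
    fix t assume t: "t \<in> {lo..hi}"
    then obtain i where i: "i \<in> I" "g i t \<ge> 0"
      using cover by blast
    have "g i lo \<ge> 0 \<or> g i hi \<ge> 0"
      using single_crossing_on_neg_between[OF sc1[OF i(1)], of lo t hi] t i(2) by force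
    then show "t \<in> A lo \<union> A hi"
      using i t by (auto simp: A_def)
  qed
  moreover have "lo \<in> A lo" "hi \<in> A hi"
    using cover[of lo] cover[of hi] \<open>lo \<le> hi\<close> by (auto simp: A_def)
  ultimately have "A lo \<inter> A hi \<inter> {lo..hi} \<noteq> {}"
    using connected_Icc[of lo hi] closed \<open>lo \<le> hi\<close> unfolding connected_closed
    by (metis (no_types, lifting) atLeastAtMost_iff disjoint_iff IntI order_refl)
  then obtain t i j where t: "t \<in> {lo..hi}"
    and i: "i \<in> I" "g i lo \<ge> 0" "g i t \<ge> 0" and j: "j \<in> I" "g j hi \<ge> 0" "g j t \<ge> 0"
    by (auto simp: A_def)
  \<comment> \<open>Single crossing reduces nonnegativity of a mixture on the whole interval to its
    two end points.\<close>
  have nonneg: "\<forall>t\<in>{lo..hi}. p * g k t + (1 - p) * g l t \<ge> 0"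
    if "k \<in> I" "l \<in> I" "p \<in> {0..1}"
      "p * g k lo + (1 - p) * g l lo \<ge> 0" "p * g k hi + (1 - p) * g l hi \<ge> 0" for k l p
    using single_crossing_on_neg_endpoint[OF sc[OF that(1-3)], of lo _ hi] that(4,5) \<open>lo \<le> hi\<close>
    by (force simp: not_le[symmetric])
  consider "g i hi \<ge> 0" | "g j lo \<ge> 0" | "g i hi < 0" "g j lo < 0"
    by linarith
  then show ?thesis
  proof cases
    case 1
    then show ?thesis
      using nonneg[of i i 1] i by (intro bexI[of _ i] bexI[of _ "1::real"]) auto
  next
    case 2
    then show ?thesis
      using nonneg[of j j 1] j by (intro bexI[of _ j] bexI[of _ "1::real"]) auto
  next
    case 3
    show ?thesis
      using i(2) 3 j(2)
    proof (rule weight_same_sign)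
      fix p assume "p \<in> {0..1}" "p * g i lo + (1 - p) * g j lo \<ge> 0"
        "p * g i hi + (1 - p) * g j hi \<ge> 0"
      then show ?thesis
        using nonneg i(1) j(1) by blast
    next
      fix p assume p: "p \<in> {0..1}" "p * g i lo + (1 - p) * g j lo < 0"
        "p * g i hi + (1 - p) * g j hi < 0"
      \<comment> \<open>Negative at both ends would force negative at the common type
        \<open>t\<close>, where both functions are nonnegative.\<close>
      have "p * g i t + (1 - p) * g j t < 0"
        using single_crossing_on_neg_between[OF sc[OF i(1) j(1) p(1)], of lo t hi] p t by force
      moreover have "p * g i t + (1 - p) * g j t \<ge> 0"
        using p(1) i(3) j(3) by (intro add_nonneg_nonneg mult_nonneg_nonneg) auto
      ultimately show ?thesis
        by linarith
    qed
  qed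
qed

lemma finite_bundles: "finite (bundles n)"
  by (simp add: bundles_def)

lemma return_pmf_in_stochastic_bundles [simp]:
  "return_pmf b \<in> stochastic_bundles n \<longleftrightarrow> b \<in> bundles n"
  by (simp add: stochastic_bundles_def)

lemma virtual_value_return [simp]:
  "virtual_value T F f v (return_pmf b) t = bundle_virtual_value T F f v b t"
  by (simp add: virtual_value_def)

text \<open>As the image of a biased coin, its expectations become two-term sums when
  \<open>p\<close> is in \<open>{0..1}\<close>. The case \<open>x = y\<close> covers a single
  bundle.\<close>

definition mix :: "real \<Rightarrow> 'a \<Rightarrow> 'a \<Rightarrow> 'a pmf" where
  "mix p x y = map_pmf (\<lambda>h. if h then x else y) (bernoulli_pmf p)"

lemma set_mix: "set_pmf (mix p x y) \<subseteq> {x, y}"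
  by (auto simp: mix_def)

lemma virtual_value_mix:
  assumes "p \<in> {0..1}"
  shows "virtual_value T F f v (mix p x y) t =
    p * bundle_virtual_value T F f v x t + (1 - p) * bundle_virtual_value T F f v y t"
  using assms by (simp add: virtual_value_def mix_def)

context bundling_model
begin

text \<open>\<open>F\<close> has a Lebesgue density, hence no atoms, and a distribution function
  jumps only at atoms.\<close>

lemma continuous_cdf: "continuous_on S (cdf F)"
proof -
  interpret prob_space F
    by (rule prob)
  have sets: "sets F = sets borel"
    using density by simp
  interpret finite_borel_measure F
    using sets by unfold_locales
  \<comment> \<open>The density \<open>f\<close> is constrained only on the interval, so
    measurability is derived for its truncation, from continuity there.\<close>
  have meas: "(\<lambda>t. ennreal (f t * indicator {lo..hi} t)) \<in> borel_measurable lborel"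
  proof -
    have "(\<lambda>t. indicator {lo..hi} t *\<^sub>R f t) \<in> borel_measurable borel"
      using density_continuous by (intro borel_measurable_continuous_on_indicator) auto
    then show ?thesis
      by (simp add: mult.commute)
  qed
  have "emeasure F {x} = 0" for x
  proof -
    have "(\<integral>\<^sup>+ t. ennreal (f t * indicator {lo..hi} t) * indicator {x} t \<partial>lborel) =
        (\<integral>\<^sup>+ (t::real). 0 \<partial>lborel)"
      by (rule nn_integral_cong_AE, rule eventually_mono[OF AE_lborel_singleton[of x]]) auto
    then show ?thesis
      by (subst density) (simp add: emeasure_density[OF meas])
  qed
  then have "isCont (cdf F) x" for x
    by (simp add: isCont_cdf measure_def)
  then show ?thesis
    by (simp add: continuous_at_imp_continuous_on)
qed

lemma continuous_bundle_virtual_value: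
  assumes "b \<in> bundles n"
  shows "continuous_on {lo..hi} (bundle_virtual_value {lo..hi} F f v b)"
proof -
  have "continuous_on {lo..hi} (v (return_pmf b))"
    using value_differentiable[of "return_pmf b"] assms
    by (auto intro!: differentiable_imp_continuous_on simp: differentiable_on_def)
  then show ?thesis
    unfolding bundle_virtual_value_def
    using assms density_pos
    by (intro continuous_intros continuous_cdf density_continuous value_deriv_continuous)
      (auto simp: less_imp_neq[symmetric])
qed

end

text \<open>If \<open>b\<close> were strictly best at some type, any average over bundles would fall
  strictly below its virtual value there, unless all the mass sits on \<open>b\<close>.\<close>

lemma never_strict_best_response_if_very_weakly_dominated:
  assumes "very_weakly_dominated n T (virtual_value T F f v) (return_pmf b)"
  shows "never_strict_best_response n T (virtual_value T F f v) b"
  unfolding never_strict_best_response_def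
proof (rule ballI, rule ccontr)
  fix t assume "t \<in> T"
  let ?w = "\<lambda>c. bundle_virtual_value T F f v c t"
  assume "\<not> (\<exists>b'\<in>bundles n. b' \<noteq> b \<and>
    virtual_value T F f v (return_pmf b) t \<le> virtual_value T F f v (return_pmf b') t)"
  then have less: "?w c < ?w b" if "c \<in> bundles n" "c \<noteq> b" for c
    using that by force
  obtain a where a: "set_pmf a \<subseteq> bundles n" "a \<noteq> return_pmf b"
    and le: "?w b \<le> measure_pmf.expectation a ?w"
    using assms \<open>t \<in> T\<close>
    by (auto simp: very_weakly_dominated_def stochastic_bundles_def virtual_value_def)
  have fin: "finite (set_pmf a)"
    using a(1) finite_bundles finite_subset by blast
  note [simp] = integrable_measure_pmf_finite[OF fin]
  have nonneg: "AE c in measure_pmf a. 0 \<le> ?w b - ?w c"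
    using less a(1) by (auto simp: AE_measure_pmf_iff intro: less_imp_le)
  have "measure_pmf.expectation a (\<lambda>c. ?w b - ?w c) \<le> 0"
    using le by simp
  \<comment> \<open>A nonnegative loss with mean zero vanishes on the support of \<open>a\<close>,
    and only \<open>b\<close> itself has loss zero.\<close>
  then have "measure_pmf.expectation a (\<lambda>c. ?w b - ?w c) = 0"
    using integral_nonneg_AE[OF nonneg] by linarith
  then have "AE c in measure_pmf a. ?w b - ?w c = 0"
    using integral_nonneg_eq_0_iff_AE[OF _ nonneg] by simp
  then have "set_pmf a \<subseteq> {b}"
    using less a(1) by (force simp: AE_measure_pmf_iff)
  then show False
    using a(2) by (simp add: set_pmf_subset_singleton)
qed

theorem proposition1:
  fixes n :: nat and lo hi :: real
    and F :: "real measure" and f :: "real \<Rightarrow> real"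
    and v \<phi> :: "nat set pmf \<Rightarrow> real \<Rightarrow> real" and b :: "nat set"
  assumes model: "bundling_model n lo hi F f v"
    and phi_virtual: "\<phi> = virtual_value {lo..hi} F f v"
    and single_crossing:
      "\<And>a a'. a \<in> stochastic_bundles n \<Longrightarrow> a' \<in> stochastic_bundles n \<Longrightarrow>
         single_crossing_on {lo..hi} (\<lambda>t. \<phi> a t - \<phi> a' t)"
    and b_bundle: "b \<in> bundles n"
  shows "never_strict_best_response n {lo..hi} \<phi> b \<longleftrightarrow>
         very_weakly_dominated n {lo..hi} \<phi> (return_pmf b)"
proof
  interpret bundling_model n lo hi F f v
    by (rule model)
  let ?w = "bundle_virtual_value {lo..hi} F f v"
  let ?g = "\<lambda>c t. ?w c t - ?w b t"
  have mix_bundles: "mix p c d \<in> stochastic_bundles n" if "c \<in> bundles n" "d \<in> bundles n" for p c d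
    using set_mix[of p c d] that by (auto simp: stochastic_bundles_def)
  \<comment> \<open>The weights sum to one, so mixtures of the differences are differences of
    virtual values of two stochastic bundles, to which the single-crossing hypothesis
    applies.\<close>
  have mix_diff: "\<phi> (mix p c d) t - \<phi> (return_pmf b) t = p * ?g c t + (1 - p) * ?g d t"
    if "p \<in> {0..1}" for p c d t
    using that by (simp add: phi_virtual virtual_value_mix algebra_simps)
  assume never: "never_strict_best_response n {lo..hi} \<phi> b"
  have "\<exists>c\<in>bundles n - {b}. \<exists>d\<in>bundles n - {b}. \<exists>p\<in>{0..1}.
      \<forall>t\<in>{lo..hi}. p * ?g c t + (1 - p) * ?g d t \<ge> 0"
  proof (rule nonneg_convex_combination)
    show "lo \<le> hi" "finite (bundles n - {b})"
      using types finite_bundles by auto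
    show "continuous_on {lo..hi} (?g c)" if "c \<in> bundles n - {b}" for c
      using that b_bundle by (intro continuous_intros continuous_bundle_virtual_value) auto
    show "\<exists>c\<in>bundles n - {b}. ?g c t \<ge> 0" if "t \<in> {lo..hi}" for t
      using never that by (force simp: never_strict_best_response_def phi_virtual)
    show "single_crossing_on {lo..hi} (\<lambda>t. p * ?g c t + (1 - p) * ?g d t)"
      if "c \<in> bundles n - {b}" "d \<in> bundles n - {b}" "p \<in> {0..1}" for c d p
      using single_crossing[of "mix p c d" "return_pmf b"] that b_bundle
      by (simp add: mix_bundles mix_diff)
  qed
  then obtain c d p where cd: "c \<in> bundles n" "c \<noteq> b" "d \<in> bundles n" "d \<noteq> b" and p: "p \<in> {0..1}"
    and "\<And>t. t \<in> {lo..hi} \<Longrightarrow> p * ?g c t + (1 - p) * ?g d t \<ge> 0"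
    by blast
  then have "\<And>t. t \<in> {lo..hi} \<Longrightarrow> \<phi> (return_pmf b) t \<le> \<phi> (mix p c d) t"
    unfolding mix_diff[OF p, symmetric] by simp
  \<comment> \<open>The support of the mixture lies in \<open>{c, d}\<close>, which avoids
    \<open>b\<close>.\<close>
  moreover have "mix p c d \<noteq> return_pmf b"
    using set_mix[of p c d] cd by auto
  ultimately show "very_weakly_dominated n {lo..hi} \<phi> (return_pmf b)"
    unfolding very_weakly_dominated_def using mix_bundles cd by blast
next
  assume "very_weakly_dominated n {lo..hi} \<phi> (return_pmf b)"
  then show "never_strict_best_response n {lo..hi} \<phi> b"
    unfolding phi_virtual by (rule never_strict_best_response_if_very_weakly_dominated)
qed

end
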